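(* For all density matrices $\rho,\sigma$, $$\mathsf{F}_0^{\mathrm{spec}}(\rho,\sigma)=\mathsf{F}_1^{\mathrm{spec}}(\rho,\sigma)=1,\qquad \mathsf{F}_{1/2}^{\mathrm{spec}}(\rho,\sigma)=\operatorname{Tr}\sqrt{\rho^{1/2}\sigma\rho^{1/2}}=F(\rho,\sigma),$$ where $F(\rho,\sigma)$ denotes the Uhlmann (root) fidelity.
   Context: A density matrix (density operator, state) is a positive semidefinite complex $n\times n$ matrix of trace one. For positive definite $A,B$, the matrix geometric mean is $A\sharp B=A^{1/2}(A^{-1/2}BA^{-1/2})^{1/2}A^{1/2}$. The weighted spectral fidelity of density matrices $\rho,\sigma$ is $\mathsf{F}_t^{\mathrm{spec}}(\rho,\sigma)=\operatorname{Tr}\big(\rho\,(\rho^{-1}\sharp\sigma)^{2t}\big)$ for $t\in[0,1]$; for singular density matrices, inverse and fractional powers are interpreted on the support of the corresponding operator. The Uhlmann (root) fidelity is $F(\rho,\sigma)=\operatorname{Tr}\sqrt{\rho^{1/2}\sigma\rho^{1/2}}$.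
   Formalization: F_1(ρ,σ)=1 is stated only when the support of σ lies in that of ρ (automatic for invertible ρ); with powers on supports it fails otherwise, e.g. ρ=diag(1,0), σ=diag(0,1) gives F_1=0. The zeroth power is taken as the identity. *)

theory Defs
  imports Complex_Main "Jordan_Normal_Form.Schur_Decomposition" "Jordan_Normal_Form.Matrix_Kernel"
begin

definition tr :: "complex mat \<Rightarrow> complex" where
  "tr A = (\<Sum>i<dim_row A. A $$ (i, i))"

definition unitary_mat :: "nat \<Rightarrow> complex mat \<Rightarrow> bool" where
  "unitary_mat n U \<longleftrightarrow>
     U \<in> carrier_mat n n \<and> mat_adjoint U * U = 1\<^sub>m n \<and> U * mat_adjoint U = 1\<^sub>m n"

definition psd_mat :: "nat \<Rightarrow> complex mat \<Rightarrow> bool" where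
  "psd_mat n A \<longleftrightarrow>
     A \<in> carrier_mat n n \<and> mat_adjoint A = A \<and>
     (\<forall>v \<in> carrier_vec n. Im ((A *\<^sub>v v) \<bullet>c v) = 0 \<and> 0 \<le> Re ((A *\<^sub>v v) \<bullet>c v))"

definition density_mat :: "nat \<Rightarrow> complex mat \<Rightarrow> bool" where
  "density_mat n A \<longleftrightarrow> psd_mat n A \<and> tr A = 1"

text \<open>The support of a Hermitian matrix: the orthogonal complement of its kernel.\<close>

definition supp_mat :: "complex mat \<Rightarrow> complex vec set" where
  "supp_mat A =
     {v \<in> carrier_vec (dim_row A). \<forall>w \<in> mat_kernel A. v \<bullet>c w = 0}"

text \<open>Spectral functional calculus for Hermitian matrices: if \<open>A = U diag(d) U\<^sup>*\<close> with \<open>U\<close> unitary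
  and \<open>d\<close> real, then \<open>f(A) = U diag(f \<circ> d) U\<^sup>*\<close>. The result does not depend on the chosen
  diagonalisation, see \<open>spectral_fun_unique\<close> and \<open>spectral_fun_eqI\<close> below.\<close>

definition spectral_fun :: "(real \<Rightarrow> real) \<Rightarrow> complex mat \<Rightarrow> complex mat \<Rightarrow> bool" where
  "spectral_fun f A B \<longleftrightarrow>
     (\<exists>U d. unitary_mat (dim_row A) U \<and>
        A = U * mat_diag (dim_row A) (\<lambda>i. complex_of_real (d i)) * mat_adjoint U \<and>
        B = U * mat_diag (dim_row A) (\<lambda>i. complex_of_real (f (d i))) * mat_adjoint U)"

definition mat_fun :: "(real \<Rightarrow> real) \<Rightarrow> complex mat \<Rightarrow> complex mat" where
  "mat_fun f A = (THE B. spectral_fun f A B)"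

lemma mat_adjoint_dims: "U \<in> carrier_mat n m \<Longrightarrow> mat_adjoint U \<in> carrier_mat m n"
  unfolding mat_adjoint_def by auto

lemma spectral_fun_unique:
  assumes "spectral_fun f A B" "spectral_fun f A C"
  shows "B = C"
proof -
  define n where "n = dim_row A"
  let ?D = "\<lambda>d :: nat \<Rightarrow> real. mat_diag n (\<lambda>i. complex_of_real (d i))"
  obtain U d where U: "unitary_mat n U" and AU: "A = U * ?D d * mat_adjoint U"
    and B: "B = U * ?D (\<lambda>i. f (d i)) * mat_adjoint U"
    using assms(1) unfolding spectral_fun_def n_def by blast
  obtain V e where V: "unitary_mat n V" and AV: "A = V * ?D e * mat_adjoint V"
    and C: "C = V * ?D (\<lambda>i. f (e i)) * mat_adjoint V"
    using assms(2) unfolding spectral_fun_def n_def by blast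
  note c = assoc_mult_mat mult_carrier_mat mat_diag_dim
  have Uc: "U \<in> carrier_mat n n" "mat_adjoint U \<in> carrier_mat n n"
    and UU: "mat_adjoint U * U = 1\<^sub>m n" "U * mat_adjoint U = 1\<^sub>m n"
    using U mat_adjoint_dims unfolding unitary_mat_def by auto
  have Vc: "V \<in> carrier_mat n n" "mat_adjoint V \<in> carrier_mat n n"
    and VV: "mat_adjoint V * V = 1\<^sub>m n" "V * mat_adjoint V = 1\<^sub>m n"
    using V mat_adjoint_dims unfolding unitary_mat_def by auto
  define W where "W = mat_adjoint V * U"
  have Wc: "W \<in> carrier_mat n n" using Uc Vc unfolding W_def by auto
  have L: "mat_adjoint V * (U * ?D g * mat_adjoint U) * U = W * ?D g" for g
  proof -
    have "mat_adjoint V * (U * ?D g * mat_adjoint U) * U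
        = mat_adjoint V * (U * ?D g * (mat_adjoint U * U))"
      using Uc Vc by (simp add: assoc_mult_mat[of _ n n _ n _ n] mult_carrier_mat[of _ n n _ n])
    also have "\<dots> = mat_adjoint V * (U * ?D g)"
      using Uc unfolding UU by (simp add: right_mult_one_mat[of _ n n] mult_carrier_mat[of _ n n _ n])
    also have "\<dots> = W * ?D g"
      using Uc Vc unfolding W_def by (simp add: assoc_mult_mat[of _ n n _ n _ n])
    finally show ?thesis .
  qed
  have R: "mat_adjoint V * (V * ?D g * mat_adjoint V) * U = ?D g * W" for g
  proof -
    have "mat_adjoint V * (V * ?D g * mat_adjoint V) * U
        = (mat_adjoint V * V) * (?D g * (mat_adjoint V * U))"
      using Uc Vc by (simp add: assoc_mult_mat[of _ n n _ n _ n] mult_carrier_mat[of _ n n _ n])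
    also have "\<dots> = ?D g * W"
      using Uc Vc unfolding VV W_def by (simp add: left_mult_one_mat[of _ n n] mult_carrier_mat[of _ n n _ n])
    finally show ?thesis .
  qed
  have eq: "W * ?D d = ?D e * W"
    using L[of d] R[of e] AU AV by metis
  have ent: "W $$ (i, j) * complex_of_real (d j) = complex_of_real (e i) * W $$ (i, j)"
    if "i < n" "j < n" for i j
    using arg_cong[OF eq, of "\<lambda>M. M $$ (i, j)"] that Wc
    by (simp add: mat_diag_mult_left[OF Wc] mat_diag_mult_right[OF Wc])
  have "W $$ (i, j) * complex_of_real (f (d j)) = complex_of_real (f (e i)) * W $$ (i, j)"
    if "i < n" "j < n" for i j
    using ent[OF that] by (cases "W $$ (i, j) = 0") auto
  then have eqf: "W * ?D (\<lambda>i. f (d i)) = ?D (\<lambda>i. f (e i)) * W"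
    using Wc by (intro eq_matI) (auto simp: mat_diag_mult_left[OF Wc] mat_diag_mult_right[OF Wc])
  have conj_back: "V * (mat_adjoint V * X * U) * mat_adjoint U = X" if "X \<in> carrier_mat n n" for X
  proof -
    have "V * (mat_adjoint V * X * U) * mat_adjoint U
        = (V * mat_adjoint V) * (X * (U * mat_adjoint U))"
      using Uc Vc that by (simp add: assoc_mult_mat[of _ n n _ n _ n] mult_carrier_mat[of _ n n _ n])
    then show ?thesis using that unfolding UU VV by simp
  qed
  have "mat_adjoint V * B * U = mat_adjoint V * C * U"
    unfolding B C L R using eqf .
  moreover have "B \<in> carrier_mat n n" "C \<in> carrier_mat n n"
    unfolding B C using Uc Vc by auto
  ultimately show ?thesis using conj_back by metis
qed

lemma spectral_fun_eqI: "spectral_fun f A B \<Longrightarrow> mat_fun f A = B"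
  unfolding mat_fun_def using spectral_fun_unique by blast

text \<open>Real powers of a positive semidefinite matrix. For \<open>s \<noteq> 0\<close>, in particular for negative and
  fractional \<open>s\<close>, the power is taken on the support and is zero on the kernel
  (recall \<open>0 powr s = 0\<close>). The power with exponent zero is the ordinary one, \<open>A\<^sup>0 = I\<close>,
  also for singular \<open>A\<close>.\<close>

definition mat_powr :: "complex mat \<Rightarrow> real \<Rightarrow> complex mat" where
  "mat_powr A s = mat_fun (\<lambda>x. if s = 0 then 1 else x powr s) A"

definition geometric_mean :: "complex mat \<Rightarrow> complex mat \<Rightarrow> complex mat" where
  "geometric_mean A B =
     mat_powr A (1/2) * mat_powr (mat_powr A (-1/2) * B * mat_powr A (-1/2)) (1/2) * mat_powr A (1/2)"

definition spectral_fidelity :: "real \<Rightarrow> complex mat \<Rightarrow> complex mat \<Rightarrow> complex" where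
  "spectral_fidelity t \<rho> \<sigma> =
     tr (\<rho> * mat_powr (geometric_mean (mat_powr \<rho> (-1)) \<sigma>) (2 * t))"

text \<open>For singular \<open>\<rho>\<close> these support conventions give \<open>F\<^sub>1(\<rho>,\<sigma>) = tr (P \<sigma>)\<close>, where \<open>P\<close> is the
  orthogonal projection onto the support of \<open>\<rho>\<close>. Hence \<open>F\<^sub>1 = 1\<close> requires that the support of \<open>\<sigma>\<close>
  is contained in that of \<open>\<rho>\<close>; for invertible \<open>\<rho>\<close> this is automatic.\<close>

definition uhlmann_fidelity :: "complex mat \<Rightarrow> complex mat \<Rightarrow> complex" where
  "uhlmann_fidelity \<rho> \<sigma> =
     tr (mat_powr (mat_powr \<rho> (1/2) * \<sigma> * mat_powr \<rho> (1/2)) (1/2))"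

end

theory Submission
  imports Defs
begin

text \<open>
  Write \<open>R = \<rho>\<^sup>1\<^sup>/\<^sup>2\<close>, \<open>Q = \<rho>\<^sup>-\<^sup>1\<^sup>/\<^sup>2\<close>, both with value zero on the kernel of \<open>\<rho>\<close>, and let
  \<open>P = R Q = Q R\<close> be the orthogonal projection onto the support of \<open>\<rho>\<close>. With \<open>S = R \<sigma> R\<close> and
  \<open>T = S\<^sup>1\<^sup>/\<^sup>2\<close>, the mean \<open>\<rho>\<^sup>-\<^sup>1 # \<sigma>\<close> is \<open>G = Q T Q\<close>, because the square root and the inverse square
  root of \<open>\<rho>\<^sup>-\<^sup>1\<close> are \<open>Q\<close> and \<open>R\<close>. It is positive semidefinite, so that \<open>G\<^sup>0 = 1\<close>, \<open>G\<^sup>1 = G\<close> and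
  \<open>G\<^sup>2 = G G\<close>, and the three values follow from the cyclicity of the trace.

  For \<open>t = 0\<close> the fidelity is \<open>tr \<rho> = 1\<close>. For \<open>t = 1/2\<close> it is \<open>tr (Q \<rho> Q T) = tr (P T)\<close>, and
  \<open>P T = T\<close>: clearly \<open>P S = S\<close>, and \<open>T = S S\<^sup>-\<^sup>1\<^sup>/\<^sup>2\<close> has its range inside that of \<open>S\<close>. For \<open>t = 1\<close> it is
  \<open>tr (P T Q Q T) = tr (Q Q S) = tr (P \<sigma>)\<close>. This is \<open>tr \<sigma> = 1\<close> once \<open>\<sigma> P = \<sigma>\<close>, which is where
  the inclusion of supports enters (\<open>mult_supp_proj_of_supp_subset\<close>).

  The identities between powers of one matrix are identities between real functions on its
  spectrum (\<open>mat_fun_mult\<close>, \<open>mat_fun_comp\<close>, \<open>mat_fun_cong_psd\<close>). To use them for matrices such as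
  \<open>S\<close> and \<open>G\<close>, of which one only knows that they are positive semidefinite, one needs the spectral
  theorem \<open>hermitian_diagonalization\<close>: without a diagonalisation the description that
  defines \<open>mat_fun\<close> would determine nothing.
\<close>

section \<open>Adjoints, inner products and the trace\<close>

lemma adjoint_index:
  fixes A :: "complex mat"
  assumes "i < dim_col A" "j < dim_row A"
  shows "mat_adjoint A $$ (i, j) = cnj (A $$ (j, i))"
  using assms unfolding mat_adjoint_def by (simp add: mat_of_rows_index)

lemma adjoint_dims [simp]:
  "dim_row (mat_adjoint A) = dim_col A" "dim_col (mat_adjoint A) = dim_row A"
  unfolding mat_adjoint_def by auto

lemma adjoint_adjoint [simp]: "mat_adjoint (mat_adjoint (A :: complex mat)) = A"
  by (rule eq_matI) (auto simp: adjoint_index)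

lemma adjoint_mult:
  fixes A B :: "complex mat"
  assumes "A \<in> carrier_mat n m" "B \<in> carrier_mat m k"
  shows "mat_adjoint (A * B) = mat_adjoint B * mat_adjoint A"
  by (rule eq_matI, insert assms)
    (auto simp: adjoint_index scalar_prod_def intro!: sum.cong)

lemma adjoint_real_diag:
  "mat_adjoint (mat_diag n (\<lambda>i. complex_of_real (d i))) = mat_diag n (\<lambda>i. complex_of_real (d i))"
  by (rule eq_matI) (auto simp: adjoint_index mat_diag_def)

lemma inner_adjoint:
  fixes A :: "complex mat"
  assumes A: "A \<in> carrier_mat n m" and v: "v \<in> carrier_vec m" and w: "w \<in> carrier_vec n"
  shows "(A *\<^sub>v v) \<bullet>c w = v \<bullet>c (mat_adjoint A *\<^sub>v w)"
proof -
  have "(A *\<^sub>v v) \<bullet>c w = (\<Sum>i<n. \<Sum>j<m. A $$ (i, j) * v $ j * cnj (w $ i))"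
    using assms by (auto simp: scalar_prod_def sum_distrib_right atLeast0LessThan intro!: sum.cong)
  also have "\<dots> = (\<Sum>j<m. \<Sum>i<n. A $$ (i, j) * v $ j * cnj (w $ i))"
    by (rule sum.swap)
  also have "\<dots> = v \<bullet>c (mat_adjoint A *\<^sub>v w)"
    using assms by (auto simp: scalar_prod_def sum_distrib_left atLeast0LessThan adjoint_index ac_simps
        intro!: sum.cong)
  finally show ?thesis .
qed

lemma tr_mult_comm:
  assumes "A \<in> carrier_mat n m" "B \<in> carrier_mat m n"
  shows "tr (A * B) = tr (B * A)"
proof -
  have "tr (A * B) = (\<Sum>i<n. \<Sum>j<m. A $$ (i, j) * B $$ (j, i))"
    using assms by (auto simp: tr_def scalar_prod_def atLeast0LessThan intro!: sum.cong)
  also have "\<dots> = (\<Sum>j<m. \<Sum>i<n. A $$ (i, j) * B $$ (j, i))"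
    by (rule sum.swap)
  also have "\<dots> = tr (B * A)"
    using assms by (auto simp: tr_def scalar_prod_def atLeast0LessThan ac_simps intro!: sum.cong)
  finally show ?thesis .
qed

lemma unitaryD:
  assumes "unitary_mat n U"
  shows "U \<in> carrier_mat n n" "mat_adjoint U \<in> carrier_mat n n"
    "mat_adjoint U * U = 1\<^sub>m n" "U * mat_adjoint U = 1\<^sub>m n"
  using assms mat_adjoint_dims unfolding unitary_mat_def by auto

lemma unitary_mult:
  assumes "unitary_mat n U" "unitary_mat n V"
  shows "unitary_mat n (U * V)"
proof -
  note U = unitaryD[OF assms(1)] and V = unitaryD[OF assms(2)]
  have adj: "mat_adjoint (U * V) = mat_adjoint V * mat_adjoint U"
    using U V by (intro adjoint_mult) auto
  have "mat_adjoint V * mat_adjoint U * (U * V) = mat_adjoint V * (mat_adjoint U * U) * V"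
    using U(1,2) V(1,2) by (simp add: assoc_mult_mat[of _ n n _ n _ n] mult_carrier_mat[of _ n n _ n])
  moreover have "U * V * (mat_adjoint V * mat_adjoint U) = U * (V * mat_adjoint V) * mat_adjoint U"
    using U(1,2) V(1,2) by (simp add: assoc_mult_mat[of _ n n _ n _ n] mult_carrier_mat[of _ n n _ n])
  ultimately show ?thesis
    using U V unfolding unitary_mat_def adj by (simp add: right_mult_one_mat[of _ n n])
qed

section \<open>The spectral theorem for Hermitian matrices\<close>

text \<open>Extend \<open>v\<close> to a basis, orthogonalise it starting from \<open>v\<close>, and divide each column by its
  norm; orthogonalisation leaves the first vector alone.\<close>

lemma unitary_extending_vector:
  fixes v :: "complex vec"
  assumes v: "v \<in> carrier_vec n" and v0: "v \<noteq> 0\<^sub>v n"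
  obtains W c where "unitary_mat n W" "col W 0 = c \<cdot>\<^sub>v v"
proof -
  interpret cof_vec_space n "TYPE(complex)" .
  note b = basis_completion[OF v v0]
  define ws where "ws = gram_schmidt n (basis_completion v)"
  have n: "n > 0" using v v0 by (cases n) auto
  obtain vs where bv: "basis_completion v = v # vs"
    using b(6,7) n by (cases "basis_completion v") auto
  have ws: "set ws \<subseteq> carrier_vec n" "corthogonal ws" "length ws = n"
    using gram_schmidt_result[OF b(2,4,5) ws_def] b(6) by auto
  have hd: "hd ws = v"
    using gram_schmidt_hd[OF v, of vs] unfolding ws_def bv .
  have ws_car: "ws ! i \<in> carrier_vec n" if "i < n" for i using ws(1,3) that by auto
  define a where "a i = csqrt (ws ! i \<bullet>c ws ! i)" for i
  \<comment> \<open>Squared norms are non-negative reals, so the complex square root is a real number too.\<close>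
  have a: "cnj (a i) = a i" "a i * a i = ws ! i \<bullet>c ws ! i" "a i \<noteq> 0" if "i < n" for i
  proof -
    define z where "z = ws ! i \<bullet>c ws ! i"
    have "z \<ge> 0" unfolding z_def by (rule conjugate_square_ge_0_vec)
    then have z: "z = complex_of_real (Re z)" "Re z \<ge> 0"
      by (auto simp: less_eq_complex_def complex_eq_iff)
    have "a i = complex_of_real (sqrt (Re z))"
      unfolding a_def z_def[symmetric] using csqrt_of_real_nonneg[of z] z
      by (metis Im_complex_of_real)
    then show "cnj (a i) = a i" by simp
    show "a i * a i = ws ! i \<bullet>c ws ! i"
      unfolding a_def by (metis power2_csqrt power2_eq_square)
    moreover have "ws ! i \<bullet>c ws ! i \<noteq> 0"
      using corthogonalD[OF ws(2), of i i] ws(3) that by simp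
    ultimately show "a i \<noteq> 0" by auto
  qed
  define W where "W = mat n n (\<lambda>(i, j). (ws ! j) $ i / a j)"
  have W: "W \<in> carrier_mat n n" "mat_adjoint W \<in> carrier_mat n n"
    using mat_adjoint_dims unfolding W_def by auto
  have "mat_adjoint W * W = 1\<^sub>m n"
  proof (rule eq_matI)
    fix i j assume "i < dim_row (1\<^sub>m n)" "j < dim_col (1\<^sub>m n)"
    then have ij: "i < n" "j < n" by auto
    have "(mat_adjoint W * W) $$ (i, j) = (\<Sum>k<n. cnj ((ws ! i) $ k) / a i * ((ws ! j) $ k / a j))"
      using ij W a unfolding W_def
      by (auto simp: scalar_prod_def adjoint_index atLeast0LessThan intro!: sum.cong)
    also have "\<dots> = (\<Sum>k<n. (ws ! j) $ k * cnj ((ws ! i) $ k)) / (a i * a j)"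
      by (simp add: sum_divide_distrib ac_simps)
    also have "\<dots> = (ws ! j \<bullet>c ws ! i) / (a i * a j)"
      using ws_car[OF ij(1)] ws_car[OF ij(2)]
      by (auto simp: scalar_prod_def atLeast0LessThan intro!: sum.cong)
    also have "\<dots> = (1\<^sub>m n) $$ (i, j)"
      using corthogonalD[OF ws(2), of j i] ws(3) ij a[of i] by (auto simp flip: a(2))
    finally show "(mat_adjoint W * W) $$ (i, j) = (1\<^sub>m n) $$ (i, j)" .
  qed (use W in auto)
  moreover from this have "W * mat_adjoint W = 1\<^sub>m n"
    by (rule mat_mult_left_right_inverse[OF W(2,1)])
  ultimately have "unitary_mat n W"
    using W unfolding unitary_mat_def by simp
  moreover have "ws ! 0 = v" using hd ws(3) n by (cases ws) auto
  then have "col W 0 = (1 / a 0) \<cdot>\<^sub>v v"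
    using n v unfolding W_def by (intro eq_vecI) auto
  ultimately show ?thesis using that by blast
qed

text \<open>Deflation, by induction on the size. In an orthonormal basis that starts with an eigenvector,
  the first column of \<open>A\<close> vanishes off the diagonal. Since \<open>A\<close> is Hermitian the same holds for the
  first row and the eigenvalue is real, so \<open>A\<close> splits into this eigenvalue and a smaller Hermitian
  block.\<close>

lemma hermitian_diagonalization:
  assumes "A \<in> carrier_mat n n" and "mat_adjoint A = A"
  shows "\<exists>U d. unitary_mat n U \<and>
    A = U * mat_diag n (\<lambda>i. complex_of_real (d i)) * mat_adjoint U"
  using assms
proof (induction n arbitrary: A)
  case 0
  have "unitary_mat 0 (1\<^sub>m 0)"
    unfolding unitary_mat_def by (auto intro!: eq_matI)
  moreover have "A = 1\<^sub>m 0 * mat_diag 0 (\<lambda>i. complex_of_real (0 :: real)) * mat_adjoint (1\<^sub>m 0)"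
    using 0 by (auto intro!: eq_matI)
  ultimately show ?case by (intro exI[of _ "1\<^sub>m 0"] exI[of _ "\<lambda>_. 0"]) simp
next
  case (Suc m A)
  note A = Suc.prems(1)
  let ?n = "Suc m"
  obtain as where cp: "char_poly A = (\<Prod>a\<leftarrow>as. [:- a, 1:])" and "length as = ?n"
    using char_poly_factorized[OF A] by blast
  then obtain e es where "as = e # es" by (cases as) auto
  then have "eigenvalue A e"
    unfolding eigenvalue_root_char_poly[OF A] cp by simp
  then obtain v where v: "v \<in> carrier_vec ?n" "v \<noteq> 0\<^sub>v ?n" "A *\<^sub>v v = e \<cdot>\<^sub>v v"
    using A unfolding eigenvalue_def eigenvector_def by auto
  obtain W c where W: "unitary_mat ?n W" and Wv: "col W 0 = c \<cdot>\<^sub>v v"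
    using unitary_extending_vector[OF v(1,2)] .
  note Wc = unitaryD(1,2)[OF W] and WW = unitaryD(3,4)[OF W]
  note mult_simps = assoc_mult_mat[of _ ?n ?n _ ?n _ ?n] mult_carrier_mat[of _ ?n ?n _ ?n]
  \<comment> \<open>\<open>B\<close> is \<open>A\<close> in the basis given by the columns of \<open>W\<close>; \<open>C\<close> below is its lower right block.\<close>
  define B where "B = mat_adjoint W * A * W"
  have Bc: "B \<in> carrier_mat ?n ?n" using A Wc unfolding B_def by auto
  have B_herm: "mat_adjoint B = B"
    using A Wc Suc.prems(2) unfolding B_def
    by (simp add: adjoint_mult[of _ ?n ?n _ ?n] mult_simps)
  have col0: "B $$ (i, 0) = (if i = 0 then e else 0)" if i: "i < ?n" for i
  proof -
    have "A *\<^sub>v col W 0 = e \<cdot>\<^sub>v col W 0"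
      unfolding Wv using A v by (simp add: mult_mat_vec smult_smult_assoc mult.commute)
    moreover have "B $$ (i, 0) = row (mat_adjoint W) i \<bullet> (A *\<^sub>v col W 0)"
      using A Wc i unfolding B_def
      by (simp add: mult_simps mult_mat_vec_def)
    ultimately have "B $$ (i, 0) = e * (mat_adjoint W * W) $$ (i, 0)"
      using Wc i by simp
    then show ?thesis using i unfolding WW by simp
  qed
  have row0: "B $$ (0, j) = cnj (B $$ (j, 0))" if "j < ?n" for j
    using adjoint_index[of 0 B j] Bc that B_herm by simp
  have e_cnj: "cnj e = e"
    using row0[of 0] col0[of 0] by (metis zero_less_Suc)
  then have e_real: "complex_of_real (Re e) = e"
    by (simp add: complex_eq_iff)
  have row0: "B $$ (0, j) = (if j = 0 then e else 0)" if "j < ?n" for j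
    unfolding row0[OF that] col0[OF that] using e_cnj by simp
  define C where "C = mat m m (\<lambda>(i, j). B $$ (Suc i, Suc j))"
  have Cc: "C \<in> carrier_mat m m" unfolding C_def by simp
  have "cnj (B $$ (Suc j, Suc i)) = B $$ (Suc i, Suc j)" if "i < m" "j < m" for i j
    using adjoint_index[of "Suc i" B "Suc j"] Bc that B_herm by simp
  then have "mat_adjoint C = C"
    unfolding C_def by (intro eq_matI) (auto simp: adjoint_index)
  then obtain V d where V: "unitary_mat m V"
    and CV: "C = V * mat_diag m (\<lambda>i. complex_of_real (d i)) * mat_adjoint V"
    using Suc.IH[OF Cc] by blast
  note Vc = unitaryD(1,2)[OF V] and VV = unitaryD(3,4)[OF V]
  define blk :: "complex \<Rightarrow> complex mat \<Rightarrow> complex mat"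
    where "blk x M = four_block_mat (mat 1 1 (\<lambda>_. x)) (0\<^sub>m 1 m) (0\<^sub>m m 1) M" for x M
  have blk_mult: "blk x M * blk y N = blk (x * y) (M * N)"
    if "M \<in> carrier_mat m m" "N \<in> carrier_mat m m" for x y :: complex and M N
  proof -
    have "mat 1 1 (\<lambda>_. x) * mat 1 1 (\<lambda>_. y) = mat 1 1 (\<lambda>_. x * y)"
      by (rule eq_matI) (auto simp: scalar_prod_def)
    then show ?thesis
      using that unfolding blk_def by (subst mult_four_block_mat[of _ 1 1 _ m _ m _ _ 1 _ m]) auto
  qed
  have blk_one: "blk 1 (1\<^sub>m m) = 1\<^sub>m ?n"
    unfolding blk_def by (rule eq_matI) auto
  have blk_diag: "blk e (mat_diag m (\<lambda>i. complex_of_real (d i))) =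
      mat_diag ?n (\<lambda>i. complex_of_real (case_nat (Re e) d i))"
    using e_real by (intro eq_matI) (auto simp: blk_def mat_diag_def split: nat.splits)
  have blk_adj: "mat_adjoint (blk 1 V) = blk 1 (mat_adjoint V)"
    using Vc by (intro eq_matI) (auto simp: blk_def adjoint_index)
  have B_blk: "B = blk e C"
  proof (rule eq_matI)
    fix i j assume "i < dim_row (blk e C)" "j < dim_col (blk e C)"
    then have "i < ?n" "j < ?n" using Cc by (auto simp: blk_def)
    then show "B $$ (i, j) = blk e C $$ (i, j)"
      using Cc row0[of j] col0[of i] by (cases i; cases j) (simp_all add: blk_def C_def)
  qed (use Bc Cc in \<open>auto simp: blk_def\<close>)
  define U where "U = W * blk 1 V"
  have V'c: "blk 1 V \<in> carrier_mat ?n ?n" "blk 1 (mat_adjoint V) \<in> carrier_mat ?n ?n"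
    using Vc by (auto simp: blk_def intro!: carrier_matI)
  have "unitary_mat ?n (blk 1 V)"
    using V'c Vc VV blk_one unfolding unitary_mat_def blk_adj by (simp add: blk_mult)
  then have U: "unitary_mat ?n U"
    unfolding U_def by (rule unitary_mult[OF W])
  let ?D = "mat_diag ?n (\<lambda>i. complex_of_real (case_nat (Re e) d i))"
  have "B = blk 1 V * ?D * blk 1 (mat_adjoint V)"
    using Vc unfolding B_blk CV blk_diag[symmetric] by (simp add: blk_mult)
  moreover have "W * B * mat_adjoint W = A"
  proof -
    have "W * B * mat_adjoint W = (W * mat_adjoint W) * A * (W * mat_adjoint W)"
      using Wc A unfolding B_def by (simp add: mult_simps)
    then show ?thesis using A unfolding WW by simp
  qed
  ultimately have "A = W * (blk 1 V * ?D * blk 1 (mat_adjoint V)) * mat_adjoint W"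
    by metis
  also have "\<dots> = U * ?D * (blk 1 (mat_adjoint V) * mat_adjoint W)"
    using Wc V'c unfolding U_def by (simp add: mult_simps)
  also have "blk 1 (mat_adjoint V) * mat_adjoint W = mat_adjoint U"
    using adjoint_mult[OF Wc(1) V'c(1)] unfolding U_def blk_adj by simp
  finally have "A = U * ?D * mat_adjoint U" .
  with U show ?case by blast
qed

section \<open>Functional calculus\<close>

definition hermitian_mat :: "nat \<Rightarrow> complex mat \<Rightarrow> bool" where
  "hermitian_mat n A \<longleftrightarrow> A \<in> carrier_mat n n \<and> mat_adjoint A = A"

text \<open>Diagonalised matrices as a notion of their own, so that the functional calculus reduces to
  pointwise operations on the list of eigenvalues \<open>d\<close>.\<close>

definition udiag :: "nat \<Rightarrow> complex mat \<Rightarrow> (nat \<Rightarrow> real) \<Rightarrow> complex mat" where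
  "udiag n U d = U * mat_diag n (\<lambda>i. complex_of_real (d i)) * mat_adjoint U"

lemma psd_imp_hermitian: "psd_mat n A \<Longrightarrow> hermitian_mat n A"
  unfolding psd_mat_def hermitian_mat_def by auto

lemma hermitian_udiag:
  assumes "hermitian_mat n A"
  obtains U d where "unitary_mat n U" "A = udiag n U d"
  using hermitian_diagonalization[of A n] assms unfolding hermitian_mat_def udiag_def by metis

lemma udiag_hermitian:
  assumes "unitary_mat n U"
  shows "hermitian_mat n (udiag n U d)"
  using unitaryD(1,2)[OF assms] unfolding udiag_def hermitian_mat_def
  by (simp add: adjoint_mult[of _ n n _ n] adjoint_real_diag
      assoc_mult_mat[of _ n n _ n _ n] mult_carrier_mat[of _ n n _ n])

lemma udiag_mult:
  assumes "unitary_mat n U"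
  shows "udiag n U d * udiag n U e = udiag n U (\<lambda>i. d i * e i)"
proof -
  note U = unitaryD[OF assms]
  let ?D = "\<lambda>d. mat_diag n (\<lambda>i. complex_of_real (d i))"
  have "udiag n U d * udiag n U e = U * ?D d * (mat_adjoint U * U) * ?D e * mat_adjoint U"
    using U(1,2) unfolding udiag_def
    by (simp add: assoc_mult_mat[of _ n n _ n _ n] mult_carrier_mat[of _ n n _ n])
  also have "\<dots> = U * (?D d * ?D e) * mat_adjoint U"
    using U(1,2) unfolding U(3)
    by (simp add: assoc_mult_mat[of _ n n _ n _ n] mult_carrier_mat[of _ n n _ n]
        right_mult_one_mat[of _ n n] del: mat_diag_diag)
  finally show ?thesis unfolding udiag_def by simp
qed

lemma udiag_cong: "(\<And>i. i < n \<Longrightarrow> d i = e i) \<Longrightarrow> udiag n U d = udiag n U e"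
  unfolding udiag_def mat_diag_def by (intro arg_cong2[of _ _ _ _ "(*)"]) (auto intro!: eq_matI)

text \<open>The form of \<open>X\<^sup>* A X\<close> at \<open>v\<close> is the form of \<open>A\<close> at \<open>X v\<close>.\<close>

lemma psd_congruence:
  assumes A: "psd_mat n A" and X: "X \<in> carrier_mat n n"
  shows "psd_mat n (mat_adjoint X * A * X)"
proof -
  have Ac: "A \<in> carrier_mat n n" and Aa: "mat_adjoint A = A"
    using A unfolding psd_mat_def by auto
  have Xc: "mat_adjoint X \<in> carrier_mat n n" using X mat_adjoint_dims by auto
  note mult_simps = assoc_mult_mat[of _ n n _ n _ n] mult_carrier_mat[of _ n n _ n]
  have "mat_adjoint (mat_adjoint X * A * X) = mat_adjoint X * A * X"
    using X Xc Ac Aa by (simp add: adjoint_mult[of _ n n _ n] mult_simps)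
  moreover have "(mat_adjoint X * A * X *\<^sub>v v) \<bullet>c v = (A *\<^sub>v (X *\<^sub>v v)) \<bullet>c (X *\<^sub>v v)"
    if v: "v \<in> carrier_vec n" for v
  proof -
    have "mat_adjoint X * A * X *\<^sub>v v = mat_adjoint X *\<^sub>v (A *\<^sub>v (X *\<^sub>v v))"
      using X Xc Ac v by (simp add: assoc_mult_mat_vec[of _ n n _ n] mult_carrier_mat[of _ n n _ n])
    then show ?thesis
      using inner_adjoint[OF Xc, of "A *\<^sub>v (X *\<^sub>v v)" v] X Ac v by simp
  qed
  ultimately show ?thesis
    using A X Xc Ac unfolding psd_mat_def by simp
qed

lemma psd_diag_iff:
  "psd_mat n (mat_diag n (\<lambda>i. complex_of_real (d i))) \<longleftrightarrow> (\<forall>i<n. 0 \<le> d i)"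
    (is "psd_mat n ?D \<longleftrightarrow> _")
proof -
  have D: "(?D *\<^sub>v v) \<bullet>c v = complex_of_real (\<Sum>i<n. d i * (cmod (v $ i))\<^sup>2)"
    if v: "v \<in> carrier_vec n" for v
  proof -
    have "(?D *\<^sub>v v) $ i = complex_of_real (d i) * v $ i" if "i < n" for i
      using v that by (simp add: mat_diag_def scalar_prod_def if_distrib[of "\<lambda>x. x * _"] cong: if_cong)
    then show ?thesis
      using v by (auto simp: scalar_prod_def atLeast0LessThan complex_norm_square mult.assoc
          simp del: index_mult_mat_vec of_real_power intro!: sum.cong)
  qed
  \<comment> \<open>Evaluating the form at a unit vector isolates one diagonal entry.\<close>
  have "d i \<ge> 0" if "psd_mat n ?D" "i < n" for i
  proof -
    have "(\<Sum>j<n. d j * (cmod (unit_vec n i $ j))\<^sup>2) = d i"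
      using that(2) by (simp add: if_distrib[of cmod] if_distrib[of "\<lambda>x. x\<^sup>2"] if_distrib[of "(*) _"] cong: if_cong)
    then show ?thesis
      using that D[of "unit_vec n i"] unfolding psd_mat_def by (metis Re_complex_of_real unit_vec_carrier)
  qed
  moreover have "psd_mat n ?D" if "\<forall>i<n. 0 \<le> d i"
    using that D unfolding psd_mat_def by (auto simp: adjoint_real_diag intro!: sum_nonneg)
  ultimately show ?thesis by blast
qed

text \<open>Both directions are congruences, by \<open>U\<close> and by its adjoint, that reduce to a diagonal matrix.\<close>

lemma psd_udiag_iff:
  assumes "unitary_mat n U"
  shows "psd_mat n (udiag n U d) \<longleftrightarrow> (\<forall>i<n. 0 \<le> d i)"
proof
  note U = unitaryD[OF assms]
  let ?D = "mat_diag n (\<lambda>i. complex_of_real (d i))"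
  { assume "psd_mat n (udiag n U d)"
    then have "psd_mat n (mat_adjoint U * udiag n U d * U)"
      by (rule psd_congruence[OF _ U(1)])
    also have "mat_adjoint U * udiag n U d * U = (mat_adjoint U * U) * ?D * (mat_adjoint U * U)"
      using U(1,2) unfolding udiag_def
      by (simp add: assoc_mult_mat[of _ n n _ n _ n] mult_carrier_mat[of _ n n _ n])
    also have "\<dots> = ?D" unfolding U(3) by (simp add: left_mult_one_mat[of _ n n] right_mult_one_mat[of _ n n])
    finally show "\<forall>i<n. 0 \<le> d i" unfolding psd_diag_iff .
  next
    assume "\<forall>i<n. 0 \<le> d i"
    then have "psd_mat n (mat_adjoint (mat_adjoint U) * ?D * mat_adjoint U)"
      by (intro psd_congruence[OF _ U(2)]) (simp add: psd_diag_iff)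
    then show "psd_mat n (udiag n U d)" unfolding udiag_def by simp
  }
qed

lemma mat_fun_udiag:
  assumes "unitary_mat n U"
  shows "mat_fun f (udiag n U d) = udiag n U (\<lambda>i. f (d i))"
proof (rule spectral_fun_eqI)
  have "dim_row (udiag n U d) = n"
    using unitaryD(1)[OF assms] unfolding udiag_def by simp
  then show "spectral_fun f (udiag n U d) (udiag n U (\<lambda>i. f (d i)))"
    unfolding spectral_fun_def using assms by (auto simp: udiag_def)
qed

lemma mat_fun_hermitian:
  assumes "hermitian_mat n A"
  shows "hermitian_mat n (mat_fun f A)"
  by (rule hermitian_udiag[OF assms]) (simp add: mat_fun_udiag udiag_hermitian)

lemma mat_fun_mult:
  assumes "hermitian_mat n A"
  shows "mat_fun f A * mat_fun g A = mat_fun (\<lambda>x. f x * g x) A"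
  by (rule hermitian_udiag[OF assms]) (simp add: mat_fun_udiag udiag_mult)

lemma mat_fun_comp:
  assumes "hermitian_mat n A"
  shows "mat_fun g (mat_fun f A) = mat_fun (\<lambda>x. g (f x)) A"
  by (rule hermitian_udiag[OF assms]) (simp add: mat_fun_udiag)

lemma mat_fun_const_one:
  assumes "hermitian_mat n A"
  shows "mat_fun (\<lambda>_. 1) A = 1\<^sub>m n"
proof -
  obtain U d where U: "unitary_mat n U" and A: "A = udiag n U d"
    using hermitian_udiag[OF assms] .
  show ?thesis
    unfolding A mat_fun_udiag[OF U] using unitaryD[OF U]
    by (simp add: udiag_def right_mult_one_mat[of _ n n])
qed

text \<open>Only the values on the spectrum count. This gives \<open>A\<^sup>1 = A\<close> although \<open>x powr 1\<close> differs from
  \<open>x\<close> for negative \<open>x\<close>.\<close>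

lemma mat_fun_cong_psd:
  assumes "psd_mat n A" and "\<And>x. x \<ge> 0 \<Longrightarrow> f x = g x"
  shows "mat_fun f A = mat_fun g A"
proof -
  obtain U d where U: "unitary_mat n U" and A: "A = udiag n U d"
    using hermitian_udiag[OF psd_imp_hermitian[OF assms(1)]] .
  show ?thesis
    using assms unfolding A mat_fun_udiag[OF U] psd_udiag_iff[OF U] by (intro udiag_cong) auto
qed

lemma mat_fun_ident:
  assumes "hermitian_mat n A"
  shows "mat_fun (\<lambda>x. x) A = A"
  by (rule hermitian_udiag[OF assms]) (simp add: mat_fun_udiag)

lemma mat_fun_psd:
  assumes "hermitian_mat n A" and "\<And>x. f x \<ge> 0"
  shows "psd_mat n (mat_fun f A)"
  by (rule hermitian_udiag[OF assms(1)]) (simp add: mat_fun_udiag psd_udiag_iff assms(2))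

section \<open>Real powers and the support projection\<close>

lemma mat_powr_psd: "hermitian_mat n A \<Longrightarrow> psd_mat n (mat_powr A s)"
  unfolding mat_powr_def by (rule mat_fun_psd) auto

lemma mat_powr_zero: "hermitian_mat n A \<Longrightarrow> mat_powr A 0 = 1\<^sub>m n"
  unfolding mat_powr_def by (simp add: mat_fun_const_one)

lemma mat_powr_one:
  assumes "psd_mat n A"
  shows "mat_powr A 1 = A"
proof -
  have "mat_powr A 1 = mat_fun (\<lambda>x. x) A"
    unfolding mat_powr_def by (rule mat_fun_cong_psd[OF assms]) simp
  then show ?thesis using mat_fun_ident[OF psd_imp_hermitian[OF assms]] by simp
qed

text \<open>The zero exponent is excluded because \<open>A\<^sup>0\<close> is the identity, whereas the product of \<open>A\<^sup>a\<close> and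
  \<open>A\<^sup>-\<^sup>a\<close> is the support projection, see \<open>mat_powr_mult_inverse\<close>.\<close>

lemma mat_powr_add:
  assumes "hermitian_mat n A" and "a \<noteq> 0" "b \<noteq> 0" "a + b \<noteq> 0"
  shows "mat_powr A a * mat_powr A b = mat_powr A (a + b)"
  using assms unfolding mat_powr_def by (simp add: mat_fun_mult powr_add)

lemma mat_powr_powr:
  assumes "hermitian_mat n A" and "a \<noteq> 0" "b \<noteq> 0"
  shows "mat_powr (mat_powr A a) b = mat_powr A (a * b)"
  using assms unfolding mat_powr_def by (simp add: mat_fun_comp powr_powr)

definition supp_proj :: "complex mat \<Rightarrow> complex mat" where
  "supp_proj A = mat_fun (\<lambda>x. of_bool (x \<noteq> 0)) A"

lemma mat_powr_mult_inverse:
  assumes "hermitian_mat n A" and "a \<noteq> 0"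
  shows "mat_powr A a * mat_powr A (- a) = supp_proj A"
proof -
  have "(\<lambda>x. x powr a * x powr (- a)) = (\<lambda>x :: real. of_bool (x \<noteq> 0))"
    by (auto simp flip: powr_add)
  then show ?thesis
    using assms unfolding mat_powr_def supp_proj_def by (simp add: mat_fun_mult)
qed

lemma supp_proj_mult_mat_powr:
  assumes "hermitian_mat n A" and "a \<noteq> 0"
  shows "supp_proj A * mat_powr A a = mat_powr A a"
proof -
  have "(\<lambda>x. of_bool (x \<noteq> 0) * x powr a) = (\<lambda>x :: real. x powr a)"
    by auto
  then show ?thesis
    using assms unfolding mat_powr_def supp_proj_def by (simp add: mat_fun_mult)
qed

lemma mult_supp_proj:
  assumes "hermitian_mat n A"
  shows "A * supp_proj A = A"
proof -
  have "A * supp_proj A = mat_fun (\<lambda>x. x) A * supp_proj A"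
    by (simp add: mat_fun_ident[OF assms])
  also have "\<dots> = mat_fun (\<lambda>x. x * of_bool (x \<noteq> 0)) A"
    unfolding supp_proj_def by (rule mat_fun_mult[OF assms])
  also have "(\<lambda>x. x * of_bool (x \<noteq> 0)) = (\<lambda>x :: real. x)" by auto
  finally show ?thesis by (simp add: mat_fun_ident[OF assms])
qed

text \<open>For Hermitian matrices an inclusion of supports reverses to an inclusion of kernels. If
  \<open>A w = 0\<close>, then \<open>B B w\<close> lies in the range of \<open>B\<close>, hence in both supports, and is orthogonal to
  \<open>w\<close>; but its inner product with \<open>w\<close> is the squared norm of \<open>B w\<close>.\<close>

lemma mat_kernel_mono_of_supp:
  assumes A: "hermitian_mat n A" and B: "hermitian_mat n B"
    and supp: "supp_mat B \<subseteq> supp_mat A" and w: "w \<in> carrier_vec n" "A *\<^sub>v w = 0\<^sub>v n"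
  shows "B *\<^sub>v w = 0\<^sub>v n"
proof -
  have Ac: "A \<in> carrier_mat n n" and Bc: "B \<in> carrier_mat n n" and Ba: "mat_adjoint B = B"
    using A B unfolding hermitian_mat_def by auto
  have sa: "(B *\<^sub>v x) \<bullet>c y = x \<bullet>c (B *\<^sub>v y)" if "x \<in> carrier_vec n" "y \<in> carrier_vec n" for x y
    using inner_adjoint[OF Bc that] unfolding Ba .
  define v where "v = B *\<^sub>v (B *\<^sub>v w)"
  have Bw: "B *\<^sub>v w \<in> carrier_vec n" using Bc w by simp
  have "v \<bullet>c k = 0" if "k \<in> mat_kernel B" for k
  proof -
    have k: "k \<in> carrier_vec n" "B *\<^sub>v k = 0\<^sub>v n"
      using that Bc unfolding mat_kernel_def by auto
    show ?thesis unfolding v_def sa[OF Bw k(1)] k(2) using Bw by simp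
  qed
  then have "v \<in> supp_mat B" unfolding supp_mat_def v_def using Bc Bw by simp
  then have "v \<in> supp_mat A" using supp by blast
  moreover have "w \<in> mat_kernel A" using w Ac unfolding mat_kernel_def by auto
  ultimately have "v \<bullet>c w = 0" unfolding supp_mat_def by blast
  then have "(B *\<^sub>v w) \<bullet>c (B *\<^sub>v w) = 0" unfolding v_def sa[OF Bw w(1)] .
  then show ?thesis using conjugate_square_eq_0_vec[OF Bw] by simp
qed

text \<open>The columns of \<open>1 - P\<close>, with \<open>P\<close> the support projection of \<open>A\<close>, are in the kernel of \<open>A\<close> and
  therefore in that of \<open>B\<close>.\<close>

lemma mult_supp_proj_of_supp_subset:
  assumes A: "hermitian_mat n A" and B: "hermitian_mat n B"
    and supp: "supp_mat B \<subseteq> supp_mat A"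
  shows "B * supp_proj A = B"
proof -
  define Q where "Q = 1\<^sub>m n - supp_proj A"
  have P: "supp_proj A \<in> carrier_mat n n"
    using mat_fun_hermitian[OF A] unfolding supp_proj_def hermitian_mat_def by blast
  have Ac: "A \<in> carrier_mat n n" and Bc: "B \<in> carrier_mat n n" and Qc: "Q \<in> carrier_mat n n"
    using A B P unfolding hermitian_mat_def Q_def by auto
  have "A * Q = A * 1\<^sub>m n - A * supp_proj A"
    unfolding Q_def using Ac P by (intro mult_minus_distrib_mat) auto
  then have AQ: "A * Q = 0\<^sub>m n n" using Ac by (simp add: mult_supp_proj[OF A])
  have "col (B * Q) j = 0\<^sub>v n" if j: "j < n" for j
  proof -
    have "A *\<^sub>v col Q j = col (A * Q) j" using col_mult2[OF Ac Qc j] by simp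
    then have "A *\<^sub>v col Q j = 0\<^sub>v n" unfolding AQ using j by simp
    then have "B *\<^sub>v col Q j = 0\<^sub>v n"
      using mat_kernel_mono_of_supp[OF A B supp, of "col Q j"] Qc j by simp
    then show ?thesis using col_mult2[OF Bc Qc j] by simp
  qed
  then have "B * Q = 0\<^sub>m n n"
    using Bc Qc by (intro mat_col_eqI) auto
  moreover have "B * Q = B * 1\<^sub>m n - B * supp_proj A"
    unfolding Q_def using Bc P by (intro mult_minus_distrib_mat) auto
  ultimately have "B - B * supp_proj A = 0\<^sub>m n n" using Bc by simp
  then have "(B - B * supp_proj A) $$ (i, j) = 0" if "i < n" "j < n" for i j
    using that by simp
  then show ?thesis using Bc P by (intro eq_matI) auto
qed

section \<open>Special values of the spectral fidelity\<close>

theorem proposition3p1: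
  fixes n :: nat and \<rho> \<sigma> :: "complex mat"
  assumes "density_mat n \<rho>" and "density_mat n \<sigma>"
  shows "spectral_fidelity 0 \<rho> \<sigma> = 1 \<and>
    (supp_mat \<sigma> \<subseteq> supp_mat \<rho> \<longrightarrow> spectral_fidelity 1 \<rho> \<sigma> = 1) \<and>
    spectral_fidelity (1/2) \<rho> \<sigma> =
      tr (mat_powr (mat_powr \<rho> (1/2) * \<sigma> * mat_powr \<rho> (1/2)) (1/2)) \<and>
    tr (mat_powr (mat_powr \<rho> (1/2) * \<sigma> * mat_powr \<rho> (1/2)) (1/2)) = uhlmann_fidelity \<rho> \<sigma>"
proof -
  define P R Q where "P = supp_proj \<rho>" and "R = mat_powr \<rho> (1/2)" and "Q = mat_powr \<rho> (- 1/2)"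
  define S where "S = R * \<sigma> * R"
  define T where "T = mat_powr S (1/2)"
  define G where "G = Q * T * Q"
  have psd: "psd_mat n \<rho>" "psd_mat n \<sigma>" and tr: "tr \<rho> = 1" "tr \<sigma> = 1"
    using assms unfolding density_mat_def by auto
  note herm = psd[THEN psd_imp_hermitian]
  have R: "psd_mat n R" and Q: "psd_mat n Q"
    unfolding R_def Q_def by (rule mat_powr_psd[OF herm(1)])+
  then have adj: "mat_adjoint R = R" "mat_adjoint Q = Q" and RQc: "R \<in> carrier_mat n n" "Q \<in> carrier_mat n n"
    unfolding psd_mat_def by auto
  have S: "psd_mat n S"
    using psd_congruence[OF psd(2) RQc(1)] unfolding S_def adj .
  have T: "psd_mat n T"
    unfolding T_def by (rule mat_powr_psd[OF psd_imp_hermitian[OF S]])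
  have "psd_mat n (mat_adjoint Q * T * Q)"
    using psd_congruence[OF T RQc(2)] .
  then have G: "psd_mat n G"
    unfolding G_def adj .
  have P: "hermitian_mat n P"
    unfolding P_def supp_proj_def by (rule mat_fun_hermitian[OF herm(1)])
  have car: "\<rho> \<in> carrier_mat n n" "\<sigma> \<in> carrier_mat n n" "P \<in> carrier_mat n n"
    "S \<in> carrier_mat n n" "T \<in> carrier_mat n n" "G \<in> carrier_mat n n"
    using psd S T G P unfolding psd_mat_def hermitian_mat_def by auto
  note car = car RQc
  note mult_simps = assoc_mult_mat[of _ n n _ n _ n] mult_carrier_mat[of _ n n _ n]

  have mean: "geometric_mean (mat_powr \<rho> (- 1)) \<sigma> = G"
    unfolding geometric_mean_def G_def T_def S_def R_def Q_def
    by (simp add: mat_powr_powr[OF herm(1)])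

  have RQ: "R * Q = P" and QR: "Q * R = P"
    using mat_powr_mult_inverse[OF herm(1), of "1/2"] mat_powr_mult_inverse[OF herm(1), of "- 1/2"]
    unfolding R_def Q_def P_def by simp_all
  have PR: "P * R = R"
    using supp_proj_mult_mat_powr[OF herm(1), of "1/2"] unfolding R_def P_def by simp
  have RR: "R * R = \<rho>"
    using mat_powr_add[OF herm(1), of "1/2" "1/2"] mat_powr_one[OF psd(1)] unfolding R_def by simp
  have TT: "T * T = S"
    using mat_powr_add[OF psd_imp_hermitian[OF S], of "1/2" "1/2"] mat_powr_one[OF S]
    unfolding T_def by simp
  have PP: "P * P = P"
  proof -
    have "P * P = P * R * Q" using car unfolding RQ[symmetric] by (simp add: mult_simps)
    then show ?thesis unfolding PR RQ .
  qed
  have "Q * \<rho> * Q = (Q * R) * (R * Q)"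
    using car unfolding RR[symmetric] by (simp add: mult_simps)
  then have QrQ: "Q * \<rho> * Q = P" unfolding QR RQ PP .
  have PS: "P * S = S"
  proof -
    have "P * S = (P * R) * \<sigma> * R" using car unfolding S_def by (simp add: mult_simps)
    then show ?thesis unfolding PR S_def .
  qed
  have PT: "P * T = T"
  proof -
    \<comment> \<open>Factoring \<open>S\<close> out of its own square root transfers \<open>P S = S\<close> to \<open>T\<close>.\<close>
    define Z where "Z = mat_powr S (- 1/2)"
    have Zc: "Z \<in> carrier_mat n n"
      using mat_powr_psd[OF psd_imp_hermitian[OF S]] unfolding Z_def psd_mat_def by blast
    have T_SZ: "T = S * Z"
      using mat_powr_add[OF psd_imp_hermitian[OF S], of 1 "- 1/2"] mat_powr_one[OF S]
      unfolding T_def Z_def by simp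
    have "P * T = (P * S) * Z" using car Zc unfolding T_SZ by (simp add: mult_simps)
    then show ?thesis unfolding PS T_SZ .
  qed

  have F0: "spectral_fidelity 0 \<rho> \<sigma> = 1"
    unfolding spectral_fidelity_def mean
    using mat_powr_zero[OF psd_imp_hermitian[OF G]] car tr by simp

  have "spectral_fidelity (1/2) \<rho> \<sigma> = tr (\<rho> * G)"
    unfolding spectral_fidelity_def mean by (simp add: mat_powr_one[OF G])
  also have "\<dots> = tr ((\<rho> * Q * T) * Q)"
    using car unfolding G_def by (simp add: mult_simps)
  also have "\<dots> = tr (Q * (\<rho> * Q * T))"
    using car by (intro tr_mult_comm) auto
  also have "Q * (\<rho> * Q * T) = (Q * \<rho> * Q) * T"
    using car by (simp add: mult_simps)
  also have "\<dots> = T" unfolding QrQ PT ..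
  finally have F_half: "spectral_fidelity (1/2) \<rho> \<sigma> = tr T" .

  have F1: "spectral_fidelity 1 \<rho> \<sigma> = 1" if supp: "supp_mat \<sigma> \<subseteq> supp_mat \<rho>"
  proof -
    have "spectral_fidelity 1 \<rho> \<sigma> = tr (\<rho> * (G * G))"
      unfolding spectral_fidelity_def mean
      using mat_powr_add[OF psd_imp_hermitian[OF G], of 1 1] mat_powr_one[OF G] by simp
    also have "\<dots> = tr ((\<rho> * Q * T * Q * Q * T) * Q)"
      using car unfolding G_def by (simp add: mult_simps)
    also have "\<dots> = tr (Q * (\<rho> * Q * T * Q * Q * T))"
      using car by (intro tr_mult_comm) auto
    also have "Q * (\<rho> * Q * T * Q * Q * T) = ((Q * \<rho> * Q) * T) * (Q * Q * T)"
      using car by (simp add: mult_simps)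
    also have "\<dots> = T * (Q * Q * T)" unfolding QrQ PT ..
    also have "tr (T * (Q * Q * T)) = tr ((Q * Q * T) * T)"
      using car by (intro tr_mult_comm) auto
    also have "(Q * Q * T) * T = Q * (Q * S)"
      using car unfolding TT[symmetric] by (simp add: mult_simps)
    also have "\<dots> = (Q * (Q * R) * \<sigma>) * R"
      using car unfolding S_def by (simp add: mult_simps)
    also have "tr \<dots> = tr (R * (Q * (Q * R) * \<sigma>))"
      using car by (intro tr_mult_comm) auto
    also have "R * (Q * (Q * R) * \<sigma>) = (R * Q) * (Q * R) * \<sigma>"
      using car by (simp add: mult_simps)
    also have "\<dots> = P * \<sigma>" unfolding RQ QR PP ..
    also have "tr (P * \<sigma>) = tr (\<sigma> * P)"
      using car by (intro tr_mult_comm) auto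
    also have "\<sigma> * P = \<sigma>"
      unfolding P_def by (rule mult_supp_proj_of_supp_subset[OF herm supp])
    finally show ?thesis using tr by simp
  qed

  show ?thesis
    using F0 F1 F_half unfolding uhlmann_fidelity_def T_def S_def R_def by simp
qed

end
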